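(* Let $f_1(x)=\cdots=f_n(x)=0$ be a system of real $(d,\ell)$-dense fewnomials in $n$ variables (whose matrix of coefficients of the monomials $x^{w_1},\dots,x^{w_n}$ is invertible) and let $$y^{\beta_j}\cdot h(y)^{\gamma_j}=1,\qquad j=1,\dots,\ell,\qquad(\ast)$$ be its corresponding dual $(d,\ell)$-dense Gale system. Then the number of nondegenerate positive solutions to $f_1=\cdots=f_n=0$ is equal to the number of nondegenerate positive solutions to $(\ast)$ where $h_i(y)>0$ for each $i=1,\dots,n$. If the exponents $\mathcal{A}$ affinely span a sublattice of $\mathbb{Z}^n$ of odd index and the relations $(\beta_j,\gamma_j)\in\mathbb{Z}^\ell\oplus\mathbb{Z}^n$ for $j=1,\dots,\ell$ span a $\mathbb{Z}$-submodule of odd index in the module of all linear relations among $v_1,\dots,v_\ell,w_1,\dots,w_n$, then the number of nondegenerate real solutions to $f_1=\cdots=f_n=0$ (in $(\mathbb{R}^\times)^n$) is equal to the number of nondegenerate real solutions to $(\ast)$ in $(\mathbb{R}^\times)^\ell$ where no $h_i(y)$ vanishes.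
   Context: Let $d,\ell,n$ be positive integers and $P=\{p\in\mathbb{Z}^\ell_{\ge0}: p_1+\cdots+p_\ell\le d\}$. A set $\mathcal{A}\subset\mathbb{Z}^n$ is $(d,\ell)$-dense if $\mathcal{A}=\psi(P)\cup\mathcal{W}$ with $\psi:\mathbb{Z}^\ell\to\mathbb{Z}^n$ affine-linear and $\mathcal{W}=\{w_1,\dots,w_n\}$ consisting of $n$ affinely independent vectors. A $(d,\ell)$-dense fewnomial is a Laurent polynomial with exponents in such a set. Translating $\mathcal{A}$ by $-\psi(0)$ (i.e. multiplying all $f_i$ by $x^{-\psi(0)}$, which does not change the solutions in the torus), one takes $\psi(0)=0$, so $\psi$ is linear. Put $v_m=\psi(e_m)$, $m=1,\dots,\ell$, the images of the standard basis vectors. Dual Gale system: each $f_i$ is a real linear combination of the monomials $x^{\psi(p)}$ ($p\in P$) and $x^{w_1},\dots,x^{w_n}$. The matrix of coefficients of $x^{w_1},\dots,x^{w_n}$ in $f_1,\dots,f_n$ being invertible, solve for these monomials to get the equivalent system $x^{w_i}=\sum_{p\in P}a_{i,p}x^{\psi(p)}$, $i=1,\dots,n$, and set $h_i(y)=\sum_{p\in P}a_{i,p}y^p$ for $y=(y_1,\dots,y_\ell)$. A linear relation among the vectors is $(\beta,\gamma)=(b_1,\dots,b_\ell,c_1,\dots,c_n)\in\mathbb{Z}^\ell\oplus\mathbb{Z}^n$ with $\sum_m b_mv_m+\sum_i c_iw_i=0$. For such, $y^\beta=\prod_m y_m^{b_m}$ and $h(y)^\gamma=\prod_i h_i(y)^{c_i}$.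 The dual Gale system is $(\ast)$, where $(\beta_j,\gamma_j)$, $j=1,\dots,\ell$, is a basis for the $\mathbb{Z}$-module of all linear relations among $v_1,\dots,v_\ell,w_1,\dots,w_n$; in the second part of the theorem the $(\beta_j,\gamma_j)$ are only required to span a submodule of odd index, and $(\ast)$ is formed with them. A set affinely spans a sublattice of odd index if the subgroup generated by differences of its elements has finite odd index in $\mathbb{Z}^n$. Positive solutions are those with all coordinates positive. Nondegenerate means the Jacobian of the system is invertible at the solution. *)

theory Defs
  imports
    "HOL-Analysis.Analysis"
    "HOL-Library.Equipollence"
    "HOL-Library.Poly_Mapping"
    "HOL-Computational_Algebra.Group_Closure"
begin

subsection \<open>Laurent polynomials\<close>

text \<open>
  A real Laurent polynomial in variables indexed by \<^typ>\<open>'n\<close> is a finitely supported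
  map from exponent vectors to coefficients; \<^const>\<open>Poly_Mapping.keys\<close> is its set of exponents.
\<close>

type_synonym 'n laurent = "(int ^ 'n) \<Rightarrow>\<^sub>0 real"

definition lmonom :: "int ^ 'n \<Rightarrow> real ^ 'n \<Rightarrow> real" where
  "lmonom a x = (\<Prod>k\<in>UNIV. (x $ k) powi (a $ k))"

definition laurent_eval :: "'n::finite laurent \<Rightarrow> real ^ 'n \<Rightarrow> real" where
  "laurent_eval f x = (\<Sum>a\<in>Poly_Mapping.keys f. Poly_Mapping.lookup f a * lmonom a x)"

definition positive_vec :: "real ^ 'n \<Rightarrow> bool" where
  "positive_vec x \<longleftrightarrow> (\<forall>k. 0 < x $ k)"

definition in_torus :: "real ^ 'n \<Rightarrow> bool" where
  "in_torus x \<longleftrightarrow> (\<forall>k. x $ k \<noteq> 0)"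

text \<open>
  The systems below are differentiable at every point at which this predicate is used, so
  \<^const>\<open>jacobian\<close> is the genuine Jacobian matrix there.
\<close>

definition nondegenerate_zero :: "(real ^ 'k \<Rightarrow> real ^ 'k) \<Rightarrow> real ^ 'k \<Rightarrow> bool" where
  "nondegenerate_zero F x \<longleftrightarrow> F x = 0 \<and> invertible (jacobian F (at x))"


subsection \<open>Dense fewnomials\<close>

definition simplex_points :: "nat \<Rightarrow> (int ^ 'l) set" where
  "simplex_points d = {p. (\<forall>m. 0 \<le> p $ m) \<and> (\<Sum>m\<in>UNIV. p $ m) \<le> int d}"

definition affine_linear :: "(int ^ 'l \<Rightarrow> int ^ 'n) \<Rightarrow> bool" where
  "affine_linear \<psi> \<longleftrightarrow> Modules.additive (\<lambda>p. \<psi> p - \<psi> 0)"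

definition affinely_independent_family :: "('n::finite \<Rightarrow> int ^ 'n) \<Rightarrow> bool" where
  "affinely_independent_family w \<longleftrightarrow>
     inj w \<and> \<not> affine_dependent (range (\<lambda>i. (\<chi> k. real_of_int (w i $ k)) :: real ^ 'n))"

definition dense_exponents ::
  "nat \<Rightarrow> (int ^ 'l \<Rightarrow> int ^ 'n) \<Rightarrow> ('n::finite \<Rightarrow> int ^ 'n) \<Rightarrow> (int ^ 'n) set \<Rightarrow> bool" where
  "dense_exponents d \<psi> w A \<longleftrightarrow>
     affine_linear \<psi> \<and> affinely_independent_family w \<and> A = \<psi> ` simplex_points d \<union> range w"

text \<open>
  The Laurent polynomial with coefficient \<open>c p\<close> at the monomial with exponent \<open>\<psi> p\<close> and
  coefficient \<open>C $ j\<close> at the one with exponent \<open>w j\<close>. The exponents listed need not be distinct,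
  so \<open>c\<close> and \<open>C\<close> are data that are not determined by the polynomial alone.
\<close>

definition dense_combination ::
  "nat \<Rightarrow> (int ^ 'l \<Rightarrow> int ^ 'n) \<Rightarrow> ('n::finite \<Rightarrow> int ^ 'n) \<Rightarrow>
   (int ^ 'l \<Rightarrow> real) \<Rightarrow> real ^ 'n \<Rightarrow> 'n laurent" where
  "dense_combination d \<psi> w c C =
     (\<Sum>p\<in>simplex_points d. Poly_Mapping.single (\<psi> p) (c p)) +
     (\<Sum>j\<in>UNIV. Poly_Mapping.single (w j) (C $ j))"

definition fewnomial_map :: "('n::finite \<Rightarrow> 'n laurent) \<Rightarrow> real ^ 'n \<Rightarrow> real ^ 'n" where
  "fewnomial_map f x = (\<chi> i. laurent_eval (f i) x)"


subsection \<open>The dual Gale system\<close>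

text \<open>
  All exponents are translated by \<open>- \<psi> 0\<close>, that is, each \<open>f i\<close> is multiplied by the monomial
  with exponent \<open>- \<psi> 0\<close>, a unit on the torus.
\<close>

definition gale_v :: "(int ^ 'l \<Rightarrow> int ^ 'n) \<Rightarrow> 'l \<Rightarrow> int ^ 'n" where
  "gale_v \<psi> m = \<psi> (axis m 1) - \<psi> 0"

definition gale_w :: "(int ^ 'l \<Rightarrow> int ^ 'n) \<Rightarrow> ('n::finite \<Rightarrow> int ^ 'n) \<Rightarrow> 'n \<Rightarrow> int ^ 'n" where
  "gale_w \<psi> w i = w i - \<psi> 0"

definition linear_relations ::
  "('l::finite \<Rightarrow> int ^ 'n) \<Rightarrow> ('n::finite \<Rightarrow> int ^ 'n) \<Rightarrow> ((int ^ 'l) \<times> (int ^ 'n)) set" where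
  "linear_relations v w =
     {(b, c). (\<Sum>m\<in>UNIV. (b $ m) *s v m) + (\<Sum>i\<in>UNIV. (c $ i) *s w i) = 0}"

text \<open>
  Row \<open>i\<close> of \<open>C\<close> holds the coefficients of \<open>x^(w 1), \<dots>, x^(w n)\<close> in \<open>f i\<close>. Solving
  \<open>(\<Sum>j. C $ i $ j * x^(w j)) = - (\<Sum>p. c i p * x^(\<psi> p))\<close> for the \<open>x^(w i)\<close> gives
  \<open>x^(w i) = (\<Sum>p. a i p * x^(\<psi> p))\<close> with \<open>a = - C\<inverse> c\<close>; after the translation \<open>x^(\<psi> p)\<close>
  is the monomial \<open>y^p\<close> evaluated at \<open>y m = x^(gale_v \<psi> m)\<close>.
\<close>

definition gale_coeff ::
  "('n::finite \<Rightarrow> int ^ 'l \<Rightarrow> real) \<Rightarrow> real ^ 'n ^ 'n \<Rightarrow> 'n \<Rightarrow> int ^ 'l \<Rightarrow> real" where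
  "gale_coeff c C i p = - (\<Sum>j\<in>UNIV. matrix_inv C $ i $ j * c j p)"

definition gale_h ::
  "nat \<Rightarrow> ('n::finite \<Rightarrow> int ^ 'l \<Rightarrow> real) \<Rightarrow> real ^ 'n ^ 'n \<Rightarrow> real ^ 'l \<Rightarrow> real ^ 'n" where
  "gale_h d c C y = (\<chi> i. \<Sum>p\<in>simplex_points d. gale_coeff c C i p * lmonom p y)"

definition gale_map ::
  "(real ^ 'l \<Rightarrow> real ^ 'n) \<Rightarrow> ('l::finite \<Rightarrow> int ^ 'l) \<Rightarrow> ('l \<Rightarrow> int ^ 'n) \<Rightarrow> real ^ 'l \<Rightarrow> real ^ 'l" where
  "gale_map h \<beta> \<gamma> y = (\<chi> j. lmonom (\<beta> j) y * lmonom (\<gamma> j) (h y) - 1)"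


subsection \<open>Bases and index\<close>

definition is_Z_basis ::
  "('j::finite \<Rightarrow> int ^ 'l) \<Rightarrow> ('j \<Rightarrow> int ^ 'n) \<Rightarrow> ((int ^ 'l) \<times> (int ^ 'n)) set \<Rightarrow> bool" where
  "is_Z_basis \<beta> \<gamma> R \<longleftrightarrow>
     group_closure (range (\<lambda>j. (\<beta> j, \<gamma> j))) = R \<and>
     (\<forall>k :: 'j \<Rightarrow> int. (\<Sum>j\<in>UNIV. (k j *s \<beta> j, k j *s \<gamma> j)) = 0 \<longrightarrow> (\<forall>j. k j = 0))"

definition odd_index :: "'a::ab_group_add set \<Rightarrow> 'a set \<Rightarrow> bool" where
  "odd_index H K \<longleftrightarrow>
     H \<subseteq> K \<and> finite ((\<lambda>x. (+) x ` H) ` K) \<and> odd (card ((\<lambda>x. (+) x ` H) ` K))"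

definition affine_odd_index :: "(int ^ 'n) set \<Rightarrow> bool" where
  "affine_odd_index A \<longleftrightarrow> odd_index (group_closure {a - b | a b. a \<in> A \<and> b \<in> A}) UNIV"

end

theory Submission
  imports Defs
begin

text \<open>
  A point \<open>(y, z)\<close> of the big torus is a character of the free group on the exponents
  \<open>v 1, \<dots>, v l, w 1, \<dots>, w n\<close>, and \<open>x \<mapsto> (x^v, x^w)\<close> restricts characters of the lattice
  to it. A character killing all linear relations descends to the sublattice spanned by the
  exponents. If that sublattice contains \<open>N\<close> times the lattice and \<open>N\<close>-th roots exist uniquely in
  the group of values (the positive reals, or the nonzero reals for odd \<open>N\<close>), it extends
  uniquely to a point \<open>x\<close>; hence \<open>x \<mapsto> x^v\<close> is a bijection between the two solution sets. The
  same extension argument for additive characters into the reals, i.e. for logarithmic tangent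
  vectors, identifies the kernels of the two Jacobians.
\<close>

subsection \<open>Monomials and exponent vectors\<close>

text \<open>This is the homomorphism from the free abelian group on \<open>'j\<close> that sends the
  generator \<open>m\<close> to \<open>v m\<close>. The sum of \<open>combine v\<close> and
  \<open>combine w\<close> has the linear relations as its kernel.\<close>

definition combine :: "('j::finite \<Rightarrow> int ^ 'n) \<Rightarrow> int ^ 'j \<Rightarrow> int ^ 'n" where
  "combine v b = (\<Sum>m\<in>UNIV. (b $ m) *s v m)"

text \<open>This is the logarithmic derivative of x^a once \<open>u\<close> holds the quotients dx_k
  / x_k.\<close>

definition pairing :: "int ^ 'n \<Rightarrow> real ^ 'n \<Rightarrow> real" where
  "pairing a u = (\<Sum>k\<in>UNIV. real_of_int (a $ k) * u $ k)"

definition monomial_map :: "('j \<Rightarrow> int ^ 'n) \<Rightarrow> real ^ 'n \<Rightarrow> real ^ 'j" where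
  "monomial_map v x = (\<chi> m. lmonom (v m) x)"

definition pairing_map :: "('j \<Rightarrow> int ^ 'n) \<Rightarrow> real ^ 'n \<Rightarrow> real ^ 'j" where
  "pairing_map v u = (\<chi> m. pairing (v m) u)"

text \<open>The choice \<open>{0<..}\<close> for \<open>S\<close> gives positive vectors and
  \<open>- {0}\<close> gives the torus, so one argument serves both halves of the theorem.\<close>

definition coords_in :: "real set \<Rightarrow> real ^ 'k \<Rightarrow> bool" where
  "coords_in S x \<longleftrightarrow> (\<forall>k. x $ k \<in> S)"

lemma combine_nth: "combine v b $ k = (\<Sum>m\<in>UNIV. b $ m * v m $ k)"
  by (simp add: combine_def)

lemma combine_add_right: "combine v (a + b) = combine v a + combine v b"
  by (simp add: vec_eq_iff combine_nth distrib_right sum.distrib)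

lemma combine_diff_right: "combine v (a - b) = combine v a - combine v b"
  by (simp add: vec_eq_iff combine_nth left_diff_distrib sum_subtractf)

lemma combine_zero_right [simp]: "combine v 0 = 0"
  by (simp add: vec_eq_iff combine_nth)

lemma combine_add_left: "combine (\<lambda>m. v m + v' m) b = combine v b + combine v' b"
  by (simp add: vec_eq_iff combine_nth distrib_left sum.distrib)

lemma combine_combine: "combine v (combine p a) = combine (\<lambda>k. combine v (p k)) a"
proof -
  have "(\<Sum>m\<in>UNIV. \<Sum>k\<in>UNIV. a $ k * (p k $ m * v m $ i)) =
        (\<Sum>k\<in>UNIV. \<Sum>m\<in>UNIV. a $ k * (p k $ m * v m $ i))" for i
    by (rule sum.swap)
  then show ?thesis
    by (simp add: vec_eq_iff combine_nth sum_distrib_left sum_distrib_right mult.assoc)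
qed

lemma combine_axis: "combine v (axis m k) = k *s v m"
  by (simp add: vec_eq_iff combine_nth axis_def if_distrib [of "\<lambda>x. x * _"] cong: if_cong)

lemma combine_axis_left: "combine (\<lambda>m. axis m k) a = k *s a"
  by (simp add: vec_eq_iff combine_nth axis_def if_distrib [of "\<lambda>x. _ * x"] mult.commute
      cong: if_cong)

lemma mem_linear_relations:
  "(b, c) \<in> linear_relations v w \<longleftrightarrow> combine v b + combine w c = 0"
  by (simp add: linear_relations_def combine_def)

lemma lmonom_zero [simp]: "lmonom 0 x = 1"
  by (simp add: lmonom_def)

lemma lmonom_add: "in_torus x \<Longrightarrow> lmonom (a + b) x = lmonom a x * lmonom b x"
  by (simp add: lmonom_def in_torus_def power_int_add prod.distrib)

lemma lmonom_nonzero: "in_torus x \<Longrightarrow> lmonom a x \<noteq> 0"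
  by (simp add: lmonom_def in_torus_def)

lemma lmonom_diff: "in_torus x \<Longrightarrow> lmonom (a - b) x = lmonom a x / lmonom b x"
  by (simp add: lmonom_def in_torus_def power_int_diff prod_dividef)

lemma lmonom_axis [simp]: "lmonom (axis k m) x = x $ k powi m"
  by (simp add: lmonom_def axis_def if_distrib [of "\<lambda>e. _ powi e"] cong: if_cong)

lemma lmonom_power: "lmonom a x ^ N = lmonom a (\<chi> k. x $ k ^ N)"
  by (simp add: lmonom_def power_int_power power_int_power' mult.commute prod_power_distrib)

lemma power_int_sum:
  "(x :: real) \<noteq> 0 \<Longrightarrow> x powi (\<Sum>i\<in>I. f i) = (\<Prod>i\<in>I. x powi f i)"
  by (induction I rule: infinite_finite_induct) (auto simp: power_int_add)

lemma power_int_prod: "(\<Prod>i\<in>I. f i) powi k = (\<Prod>i\<in>I. (f i :: real) powi k)"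
  by (induction I rule: infinite_finite_induct) (auto simp: power_int_mult_distrib)

text \<open>Substituting monomials into a monomial composes the exponent matrices. Nonzero
  coordinates let a power whose exponent is a sum of integers of mixed sign split into a
  product.\<close>

lemma lmonom_monomial_map:
  assumes "in_torus x"
  shows "lmonom b (monomial_map v x) = lmonom (combine v b) x"
proof -
  have "lmonom b (monomial_map v x) = (\<Prod>m\<in>UNIV. \<Prod>k\<in>UNIV. x $ k powi (b $ m * v m $ k))"
    by (simp add: lmonom_def monomial_map_def power_int_prod mult.commute flip: power_int_mult)
  also have "\<dots> = (\<Prod>k\<in>UNIV. \<Prod>m\<in>UNIV. x $ k powi (b $ m * v m $ k))"
    by (rule prod.swap)
  also have "\<dots> = lmonom (combine v b) x"
    using assms by (simp add: lmonom_def combine_nth in_torus_def power_int_sum)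
  finally show ?thesis .
qed

lemma lmonom_mult: "lmonom a (\<chi> k. x $ k * y $ k) = lmonom a x * lmonom a y"
  by (simp add: lmonom_def power_int_mult_distrib prod.distrib)

section \<open>Exponents as functionals on logarithmic tangent vectors\<close>

lemma pairing_zero [simp]: "pairing 0 u = 0"
  by (simp add: pairing_def)

lemma pairing_add: "pairing (a + b) u = pairing a u + pairing b u"
  by (simp add: pairing_def distrib_right sum.distrib)

lemma pairing_diff: "pairing (a - b) u = pairing a u - pairing b u"
  by (simp add: pairing_def left_diff_distrib sum_subtractf)

lemma pairing_axis [simp]: "pairing (axis k m) u = of_int m * u $ k"
  by (simp add: pairing_def axis_def if_distrib [of real_of_int] if_distrib [of "\<lambda>x. x * _"]
      cong: if_cong)

lemma pairing_pairing_map: "pairing b (pairing_map v u) = pairing (combine v b) u"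
proof -
  have "(\<Sum>m\<in>UNIV. \<Sum>k\<in>UNIV. real_of_int (b $ m) * (real_of_int (v m $ k) * u $ k)) =
        (\<Sum>k\<in>UNIV. \<Sum>m\<in>UNIV. real_of_int (b $ m) * (real_of_int (v m $ k) * u $ k))"
    by (rule sum.swap)
  then show ?thesis
    by (simp add: pairing_def pairing_map_def combine_nth sum_distrib_left sum_distrib_right
        mult.assoc)
qed

lemma pairing_scaleR: "pairing a (r *\<^sub>R u) = r * pairing a u"
  by (simp add: pairing_def sum_distrib_left algebra_simps)

subsection \<open>Extension of characters\<close>

text \<open>The common ground of both halves. \<open>S\<close> is a multiplicative group of nonzero
  reals with unique \<open>N\<close>-th roots and trivial \<open>M\<close>-torsion. \<open>M\<close>
  moves every relation into the group generated by the given ones, and \<open>N\<close> moves the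
  lattice into the span of the exponents. The \<open>M\<close>-fold multiple is written as a sum,
  which makes sense for pairs of vectors.\<close>

locale gale_exponents =
  fixes v :: "'l::finite \<Rightarrow> int ^ 'n::finite" and w :: "'n \<Rightarrow> int ^ 'n"
    and \<beta> :: "'l \<Rightarrow> int ^ 'l" and \<gamma> :: "'l \<Rightarrow> int ^ 'n"
    and S :: "real set" and N M :: nat
  assumes relation: "(\<beta> j, \<gamma> j) \<in> linear_relations v w"
    and relation_multiple: "r \<in> linear_relations v w \<Longrightarrow>
      (\<Sum>i<M. r) \<in> group_closure (range (\<lambda>j. (\<beta> j, \<gamma> j)))"
    and span_multiple: "\<exists>b c. axis k (int N) = combine v b + combine w c"
    and N_pos: "N > 0" and M_pos: "M > 0"
    and nonzero: "0 \<notin> S" and one: "1 \<in> S"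
    and mult: "s \<in> S \<Longrightarrow> t \<in> S \<Longrightarrow> s * t \<in> S"
    and inverse: "s \<in> S \<Longrightarrow> inverse s \<in> S"
    and root: "s \<in> S \<Longrightarrow> \<exists>t\<in>S. t ^ N = s"
    and torsion_free_N: "s \<in> S \<Longrightarrow> s ^ N = 1 \<Longrightarrow> s = 1"
    and torsion_free_M: "s \<in> S \<Longrightarrow> s ^ M = 1 \<Longrightarrow> s = 1"
begin

lemma coords_in_torus: "coords_in S x \<Longrightarrow> in_torus x"
  using nonzero by (metis coords_in_def in_torus_def)

lemma power_int_in: "s \<in> S \<Longrightarrow> s powi k \<in> S"
proof -
  have pow: "t ^ i \<in> S" if "t \<in> S" for t and i :: nat
    by (induction i) (use that one mult in auto)
  then show "s \<in> S \<Longrightarrow> s powi k \<in> S"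
    by (auto simp: power_int_def intro: inverse)
qed

lemma prod_in: "(\<And>i. i \<in> I \<Longrightarrow> g i \<in> S) \<Longrightarrow> (\<Prod>i\<in>I. g i) \<in> S"
  by (induction I rule: infinite_finite_induct) (auto intro: one mult)

lemma lmonom_in: "coords_in S x \<Longrightarrow> lmonom a x \<in> S"
  unfolding lmonom_def by (intro prod_in power_int_in) (simp add: coords_in_def)

lemma monomial_map_in: "coords_in S x \<Longrightarrow> coords_in S (monomial_map u x)"
  using lmonom_in[of x] by (auto simp: coords_in_def monomial_map_def)

text \<open>The quotient of the two elements is \<open>N\<close>-torsion in
  \<open>S\<close>.\<close>

lemma root_unique:
  assumes "s \<in> S" "t \<in> S" "s ^ N = t ^ N"
  shows "s = t"
proof -
  have "(s * inverse t) ^ N = 1"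
    using assms nonzero by (auto simp: power_mult_distrib power_inverse intro!: right_inverse)
  then have "s * inverse t = 1"
    by (rule torsion_free_N[rotated]) (intro mult inverse assms)
  then have "inverse s = inverse t"
    by (rule inverse_unique)
  then show ?thesis by simp
qed

text \<open>The pair (y, z) defines a character of the group of exponent pairs. It is trivial on the
  generated subgroup, so its value at any relation has \<open>M\<close>-th power 1 and is 1 by
  torsion-freeness.\<close>

lemma lmonom_relation:
  assumes yz: "coords_in S y" "coords_in S z"
    and gen: "\<And>j. lmonom (\<beta> j) y * lmonom (\<gamma> j) z = 1"
    and rel: "(b, c) \<in> linear_relations v w"
  shows "lmonom b y * lmonom c z = 1"
proof -
  define ch where "ch r = lmonom (fst r) y * lmonom (snd r) z" for r
  have T: "in_torus y" "in_torus z" using yz by (auto intro: coords_in_torus)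
  have hom: "ch (r - s) = ch r / ch s" "ch (r + s) = ch r * ch s" for r s
    by (simp_all add: ch_def lmonom_diff lmonom_add T)
  have "ch r = 1" if "r \<in> group_closure (range (\<lambda>j. (\<beta> j, \<gamma> j)))" for r
    using that
  proof induction
    case (base r)
    then show ?case by (auto simp: ch_def gen)
  next
    case (diff r s)
    then show ?case by (simp add: hom)
  qed
  then have "ch (\<Sum>i<M. (b, c)) = 1"
    using relation_multiple[OF rel] by blast
  moreover have "ch (\<Sum>i<k. (b, c)) = ch (b, c) ^ k" for k :: nat
    by (induction k) (simp_all add: hom, simp add: ch_def)
  ultimately have "ch (b, c) ^ M = 1" by simp
  then have "ch (b, c) = 1"
    by (rule torsion_free_M[rotated]) (simp add: ch_def mult lmonom_in yz)
  then show ?thesis by (simp add: ch_def)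
qed

text \<open>The additive analogue: a real number whose \<open>M\<close>-fold multiple vanishes is
  0.\<close>

lemma pairing_relation:
  assumes gen: "\<And>j. pairing (\<beta> j) y + pairing (\<gamma> j) z = 0"
    and rel: "(b, c) \<in> linear_relations v w"
  shows "pairing b y + pairing c z = 0"
proof -
  define ch where "ch r = pairing (fst r) y + pairing (snd r) z" for r
  have hom: "ch (r - s) = ch r - ch s" "ch (r + s) = ch r + ch s" for r s
    by (simp_all add: ch_def pairing_diff pairing_add)
  have "ch r = 0" if "r \<in> group_closure (range (\<lambda>j. (\<beta> j, \<gamma> j)))" for r
    using that
  proof induction
    case (base r)
    then show ?case by (auto simp: ch_def gen)
  next
    case (diff r s)
    then show ?case by (simp add: hom)
  qed
  then have "ch (\<Sum>i<M. (b, c)) = 0"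
    using relation_multiple[OF rel] by blast
  moreover have "ch (\<Sum>i<k. (b, c)) = real k * ch (b, c)" for k :: nat
    by (induction k) (simp_all add: hom algebra_simps, simp add: ch_def)
  ultimately show ?thesis using M_pos by (simp add: ch_def)
qed

text \<open>Coefficients are chosen for the unit vectors only and extended linearly. Hence
  \<open>p\<close> and \<open>q\<close> do not depend on \<open>a\<close>, and the coefficients of N
  a are linear in \<open>a\<close>.\<close>

lemma span_multiple_coeffs:
  "\<exists>p q. \<forall>a. int N *s a = combine v (combine p a) + combine w (combine q a)"
proof -
  obtain p q where pq: "\<And>k. axis k (int N) = combine v (p k) + combine w (q k)"
    using span_multiple by metis
  have "int N *s a = combine v (combine p a) + combine w (combine q a)" for a
    unfolding combine_combine by (simp flip: combine_axis_left[of "int N"] combine_add_left pq)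
  then show ?thesis by blast
qed

section \<open>Unique extension of multiplicative and additive characters to the lattice\<close>

lemma monomial_maps_inj:
  assumes x: "coords_in S x" "coords_in S x'"
    and eq: "monomial_map v x = monomial_map v x'" "monomial_map w x = monomial_map w x'"
  shows "x = x'"
proof -
  have "x $ k = x' $ k" for k
  proof -
    obtain b c where bc: "axis k (int N) = combine v b + combine w c"
      using span_multiple by blast
    \<comment> \<open>The \<open>N\<close>-th power of a coordinate is a product of monomials in x^v
      and x^w, so both points share it.\<close>
    have "x $ k ^ N = lmonom (axis k (int N)) x" by simp
    also have "\<dots> = lmonom (axis k (int N)) x'"
      unfolding bc using x eq by (simp add: lmonom_add coords_in_torus flip: lmonom_monomial_map)
    also have "\<dots> = x' $ k ^ N" by simp
    finally show ?thesis using x by (intro root_unique[of "x $ k" "x' $ k"]) (auto simp: coords_in_def)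
  qed
  then show ?thesis by (simp add: vec_eq_iff)
qed

lemma pairing_maps_inj:
  assumes "pairing_map v u = 0" "pairing_map w u = 0"
  shows "u = 0"
proof -
  have "u $ k = 0" for k
  proof -
    obtain b c where bc: "axis k (int N) = combine v b + combine w c"
      using span_multiple by blast
    have "real N * u $ k = pairing (axis k (int N)) u" by simp
    also have "\<dots> = 0"
      unfolding bc pairing_add pairing_pairing_map[symmetric] by (simp add: assms pairing_def)
    finally show ?thesis using N_pos by simp
  qed
  then show ?thesis by (simp add: vec_eq_iff)
qed

text \<open>The character given by (y, z) is known on N times the lattice; unique
  \<open>N\<close>-th roots in \<open>S\<close> extend it to the whole lattice.\<close>

lemma monomial_maps_surj:
  assumes yz: "coords_in S y" "coords_in S z"
    and gen: "\<And>j. lmonom (\<beta> j) y * lmonom (\<gamma> j) z = 1"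
  obtains x where "coords_in S x" "monomial_map v x = y" "monomial_map w x = z"
proof -
  have T: "in_torus y" "in_torus z" using yz by (auto intro: coords_in_torus)
  obtain p q where pq: "\<And>a. int N *s a = combine v (combine p a) + combine w (combine q a)"
    using span_multiple_coeffs by blast
  \<comment> \<open>The right-hand side is the value of the character at N times the
    \<open>k\<close>-th unit vector, so the \<open>k\<close>-th coordinate of \<open>x\<close> has
    to be an \<open>N\<close>-th root of it.\<close>
  have "\<exists>t\<in>S. t ^ N = lmonom (p k) y * lmonom (q k) z" for k
    using yz by (intro root mult lmonom_in)
  then obtain t where t: "\<And>k. t k \<in> S" "\<And>k. t k ^ N = lmonom (p k) y * lmonom (q k) z"
    by metis
  define x where "x = (\<chi> k. t k)"
  have x: "coords_in S x" using t by (simp add: coords_in_def x_def)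
  \<comment> \<open>The value does not depend on how N a is written: two representations differ by a
    relation, on which the character is trivial.\<close>
  have ext: "lmonom a x ^ N = lmonom b y * lmonom c z"
    if "int N *s a = combine v b + combine w c" for a b c
  proof -
    have "lmonom a x ^ N = lmonom a (\<chi> k. monomial_map p y $ k * monomial_map q z $ k)"
      by (simp add: lmonom_power x_def t monomial_map_def)
    also have "\<dots> = lmonom (combine p a) y * lmonom (combine q a) z"
      by (simp add: lmonom_mult lmonom_monomial_map T)
    finally have 1: "lmonom a x ^ N = lmonom (combine p a) y * lmonom (combine q a) z" .
    have "lmonom (combine p a - b) y * lmonom (combine q a - c) z = 1"
      by (rule lmonom_relation[OF yz gen])
        (simp add: mem_linear_relations combine_diff_right trans[OF that[symmetric] pq]
          flip: add_diff_add)
    then show ?thesis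
      using lmonom_nonzero[OF T(1)] lmonom_nonzero[OF T(2)] by (simp add: 1 lmonom_diff T field_simps)
  qed
  \<comment> \<open>Among the representations of N times \<open>v m\<close> is the obvious one, N
    copies of the generator \<open>m\<close>.\<close>
  have "lmonom (v m) x = y $ m" for m
  proof (rule root_unique)
    show "lmonom (v m) x ^ N = y $ m ^ N"
      using ext[of "v m" "axis m (int N)" 0] by (simp add: combine_axis)
  qed (use x yz lmonom_in in \<open>auto simp: coords_in_def\<close>)
  moreover have "lmonom (w i) x = z $ i" for i
  proof (rule root_unique)
    show "lmonom (w i) x ^ N = z $ i ^ N"
      using ext[of "w i" 0 "axis i (int N)"] by (simp add: combine_axis)
  qed (use x yz lmonom_in in \<open>auto simp: coords_in_def\<close>)
  ultimately show ?thesis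
    using x by (intro that[of x]) (simp_all add: monomial_map_def vec_eq_iff)
qed

text \<open>The extension argument of \<open>monomial_maps_surj\<close>, with division by
  \<open>N\<close> in place of the choice of roots.\<close>

lemma pairing_maps_surj:
  assumes gen: "\<And>j. pairing (\<beta> j) y + pairing (\<gamma> j) z = 0"
  obtains u where "pairing_map v u = y" "pairing_map w u = z"
proof -
  obtain p q where pq: "\<And>a. int N *s a = combine v (combine p a) + combine w (combine q a)"
    using span_multiple_coeffs by blast
  define u where "u = (1 / real N) *\<^sub>R (pairing_map p y + pairing_map q z)"
  have ext: "real N * pairing a u = pairing b y + pairing c z"
    if "int N *s a = combine v b + combine w c" for a b c
  proof -
    have "real N * pairing a u = pairing a (pairing_map p y) + pairing a (pairing_map q z)"
      using N_pos by (simp add: u_def pairing_scaleR) (simp add: pairing_def algebra_simps sum.distrib)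
    then have 1: "real N * pairing a u = pairing (combine p a) y + pairing (combine q a) z"
      by (simp add: pairing_pairing_map)
    have "pairing (combine p a - b) y + pairing (combine q a - c) z = 0"
      by (rule pairing_relation[OF gen])
        (simp add: mem_linear_relations combine_diff_right trans[OF that[symmetric] pq]
          flip: add_diff_add)
    then show ?thesis by (simp add: 1 pairing_diff)
  qed
  have "pairing (v m) u = y $ m" for m
    using ext[of "v m" "axis m (int N)" 0] N_pos by (simp add: combine_axis)
  moreover have "pairing (w i) u = z $ i" for i
    using ext[of "w i" 0 "axis i (int N)"] N_pos by (simp add: combine_axis)
  ultimately show ?thesis
    by (intro that[of u]) (simp_all add: pairing_map_def vec_eq_iff)
qed

lemma lmonom_relation_on_image:
  assumes "in_torus x" "(b, c) \<in> linear_relations v w"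
  shows "lmonom b (monomial_map v x) * lmonom c (monomial_map w x) = 1"
  using assms by (simp add: lmonom_monomial_map mem_linear_relations flip: lmonom_add)

lemma pairing_relation_on_image:
  assumes "(b, c) \<in> linear_relations v w"
  shows "pairing b (pairing_map v u) + pairing c (pairing_map w u) = 0"
  using assms by (simp add: pairing_pairing_map mem_linear_relations flip: pairing_add)

end

subsection \<open>Jacobians\<close>

text \<open>Turns a tangent vector \<open>u\<close> at \<open>x\<close> into a logarithmic one, in
  which monomial maps become linear with integer matrix.\<close>

definition vec_divide :: "real ^ 'k \<Rightarrow> real ^ 'k \<Rightarrow> real ^ 'k" where
  "vec_divide u x = (\<chi> k. u $ k / x $ k)"

lemma has_derivative_vec:
  fixes F :: "'a::real_normed_vector \<Rightarrow> real ^ 'k::finite"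
  assumes "\<And>k. ((\<lambda>x. F x $ k) has_derivative (\<lambda>u. F' u $ k)) (at x)"
  shows "(F has_derivative F') (at x)"
  using assms
  by (subst has_derivative_componentwise_within)
    (auto simp: Basis_vec_def inner_axis)

lemma lmonom_has_derivative:
  assumes "in_torus x"
  shows "(lmonom a has_derivative (\<lambda>u. lmonom a x * pairing a (vec_divide u x))) (at x)"
proof -
  have nz: "x $ k \<noteq> 0" for k using assms by (simp add: in_torus_def)
  have factor: "((\<lambda>x. x $ k powi (a $ k)) has_derivative
      (\<lambda>u. of_int (a $ k) * u $ k / x $ k * x $ k powi (a $ k))) (at x)" for k
  proof -
    have "((\<lambda>x. x $ k powi (a $ k)) has_derivative
      (\<lambda>u. u $ k * (of_int (a $ k) * x $ k powi (a $ k - 1)))) (at x)"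
      by (rule has_derivative_power_int) (rule nz, intro bounded_linear_imp_has_derivative bounded_linear_vec_nth)
    then show ?thesis using nz[of k] by (simp add: power_int_diff mult_ac)
  qed
  have "((\<lambda>x. \<Prod>k\<in>UNIV. x $ k powi (a $ k)) has_derivative
      (\<lambda>u. \<Sum>k\<in>UNIV. of_int (a $ k) * u $ k / x $ k * x $ k powi (a $ k) *
          (\<Prod>i\<in>UNIV - {k}. x $ i powi (a $ i)))) (at x)"
    by (rule has_derivative_prod) (rule factor)
  \<comment> \<open>The factor left over by the derivative completes the product of the others, so
    every summand carries the full monomial.\<close>
  moreover have "x $ k powi (a $ k) * (\<Prod>i\<in>UNIV - {k}. x $ i powi (a $ i)) = lmonom a x" for k
    unfolding lmonom_def by (subst (2) prod.remove[of _ k]) auto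
  ultimately show ?thesis
    by (simp add: pairing_def vec_divide_def sum_distrib_left mult_ac lmonom_def[abs_def])
qed

lemma monomial_map_has_derivative:
  assumes "in_torus x"
  shows "(monomial_map v has_derivative
    (\<lambda>u. \<chi> m. monomial_map v x $ m * pairing_map v (vec_divide u x) $ m)) (at x)"
  by (rule has_derivative_vec)
    (use lmonom_has_derivative[OF assms] in \<open>simp add: monomial_map_def pairing_map_def\<close>)

text \<open>Derivatives are unique and a square matrix is invertible exactly when its kernel is
  trivial, so any explicit derivative can stand for the Jacobian matrix.\<close>

lemma nondegenerate_zero_iff:
  fixes F :: "real ^ 'k::finite \<Rightarrow> real ^ 'k"
  assumes "(F has_derivative F') (at x)"
  shows "nondegenerate_zero F x \<longleftrightarrow> F x = 0 \<and> (\<forall>u. F' u = 0 \<longrightarrow> u = 0)"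
proof -
  have "F' = frechet_derivative F (at x)"
    by (rule frechet_derivative_at[OF assms])
  then have "jacobian F (at x) *v u = F' u" for u
    using has_derivative_linear[OF assms] by (simp add: jacobian_def matrix_works)
  then show ?thesis
    by (simp add: nondegenerate_zero_def invertible_left_inverse matrix_left_invertible_ker)
qed

text \<open>At a zero of \<open>G\<close> the term with the derivative of \<mu> vanishes, so the two
  derivatives differ by an invertible factor. Away from zeros of \<open>G\<close> both sides are
  false.\<close>

lemma nondegenerate_zero_gauge:
  fixes F G :: "real ^ 'k::finite \<Rightarrow> real ^ 'k" and \<mu> :: "real ^ 'k \<Rightarrow> real"
  assumes U: "open U" "x \<in> U"
    and F: "\<And>x. x \<in> U \<Longrightarrow> F x = \<mu> x *\<^sub>R (C *v G x)"
    and \<mu>: "\<mu> differentiable (at x)" "\<mu> x \<noteq> 0"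
    and G: "(G has_derivative G') (at x)"
    and C: "invertible C"
  shows "nondegenerate_zero F x \<longleftrightarrow> nondegenerate_zero G x"
proof -
  obtain \<mu>' where \<mu>': "(\<mu> has_derivative \<mu>') (at x)"
    using \<mu>(1) by (auto simp: differentiable_def)
  have C0: "C *v z = 0 \<longleftrightarrow> z = 0" for z
    using C by (auto simp: invertible_left_inverse matrix_left_invertible_ker)
  have "((\<lambda>x. C *v G x) has_derivative (\<lambda>u. C *v G' u)) (at x)"
    using G by (rule bounded_linear.has_derivative[OF matrix_vector_mul_bounded_linear])
  then have "((\<lambda>x. \<mu> x *\<^sub>R (C *v G x)) has_derivative
      (\<lambda>u. \<mu> x *\<^sub>R (C *v G' u) + \<mu>' u *\<^sub>R (C *v G x))) (at x)"
    by (rule has_derivative_scaleR[OF \<mu>'])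
  then have F': "(F has_derivative (\<lambda>u. \<mu> x *\<^sub>R (C *v G' u) + \<mu>' u *\<^sub>R (C *v G x))) (at x)"
    by (rule has_derivative_transform_within_open[OF _ U]) (simp add: F)
  then show ?thesis
    unfolding nondegenerate_zero_iff[OF G] nondegenerate_zero_iff[OF F']
    using \<mu>(2) by (cases "G x = 0") (simp_all add: F[OF U(2)] C0)
qed

lemma monomial_map_torus:
  fixes v :: "'k::finite \<Rightarrow> int ^ 'n::finite"
  shows "in_torus x \<Longrightarrow> in_torus (monomial_map v x)"
  using lmonom_nonzero[of x] by (simp add: in_torus_def[of "\<chi> m. _ m"] monomial_map_def)

lemma open_torus: "open {x :: real ^ 'k::finite. in_torus x}"
proof -
  have "{x :: real ^ 'k. in_torus x} = (\<Inter>k. {x. x $ k \<noteq> 0})"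
    by (auto simp: in_torus_def)
  moreover have "open {x :: real ^ 'k. x $ k \<noteq> 0}" for k
    by (intro open_Collect_neq continuous_intros)
  ultimately show ?thesis by auto
qed

text \<open>At a solution each product equals 1, so its derivative coincides with its logarithmic
  derivative, which is linear in the exponents.\<close>

lemma gale_map_has_derivative:
  fixes h :: "real ^ 'l::finite \<Rightarrow> real ^ 'n::finite"
  assumes h: "(h has_derivative H) (at y)" and y: "in_torus y" "in_torus (h y)"
    and zero: "gale_map h \<beta> \<gamma> y = 0"
  shows "(gale_map h \<beta> \<gamma> has_derivative
    (\<lambda>t. \<chi> j. pairing (\<beta> j) (vec_divide t y) + pairing (\<gamma> j) (vec_divide (H t) (h y)))) (at y)"
proof (rule has_derivative_vec)
  fix j
  have 1: "lmonom (\<beta> j) y * lmonom (\<gamma> j) (h y) = 1"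
    using zero by (simp add: gale_map_def vec_eq_iff)
  have "((\<lambda>y. lmonom (\<gamma> j) (h y)) has_derivative
      (\<lambda>t. lmonom (\<gamma> j) (h y) * pairing (\<gamma> j) (vec_divide (H t) (h y)))) (at y)"
    by (rule has_derivative_compose[OF h lmonom_has_derivative[OF y(2)]])
  from has_derivative_mult[OF lmonom_has_derivative[OF y(1), of "\<beta> j"] this]
  have "((\<lambda>y. lmonom (\<beta> j) y * lmonom (\<gamma> j) (h y)) has_derivative
      (\<lambda>t. lmonom (\<beta> j) y * lmonom (\<gamma> j) (h y) * (pairing (\<beta> j) (vec_divide t y) +
          pairing (\<gamma> j) (vec_divide (H t) (h y))))) (at y)"
    by (rule has_derivative_eq_rhs) (auto simp: algebra_simps)
  then have "((\<lambda>y. lmonom (\<beta> j) y * lmonom (\<gamma> j) (h y)) has_derivative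
      (\<lambda>t. pairing (\<beta> j) (vec_divide t y) + pairing (\<gamma> j) (vec_divide (H t) (h y)))) (at y)"
    by (simp add: 1)
  from has_derivative_diff[OF this has_derivative_const[of 1]]
  show "((\<lambda>y. gale_map h \<beta> \<gamma> y $ j) has_derivative
      (\<lambda>t. (\<chi> j. pairing (\<beta> j) (vec_divide t y) + pairing (\<gamma> j) (vec_divide (H t) (h y))) $ j))
      (at y)"
    by (simp add: gale_map_def)
qed

section \<open>Comparison of Jacobian kernels and of solution sets\<close>

context gale_exponents
begin

text \<open>The derivative of x^v carries the kernel of the one Jacobian isomorphically onto the
  kernel of the other; the proof shows that one is trivial exactly when the other is.\<close>

lemma nondegenerate_zero_dual:
  fixes h :: "real ^ 'l \<Rightarrow> real ^ 'n"
  assumes x: "in_torus x" "monomial_map v x = y" "monomial_map w x = h y"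
    and h: "(h has_derivative H) (at y)"
  shows "nondegenerate_zero (\<lambda>x. monomial_map w x - h (monomial_map v x)) x \<longleftrightarrow>
    nondegenerate_zero (gale_map h \<beta> \<gamma>) y"
proof -
  have y: "in_torus y" "in_torus (h y)"
    using monomial_map_torus[OF x(1), of v] monomial_map_torus[OF x(1), of w] by (simp_all add: x)
  have zero: "gale_map h \<beta> \<gamma> y = 0"
    using lmonom_relation_on_image[OF x(1) relation] x by (simp add: gale_map_def vec_eq_iff)
  \<comment> \<open>\<open>yv\<close> and \<open>zw\<close> are the derivatives of x^v and x^w at
    \<open>x\<close>, with the values of these maps already replaced by \<open>y\<close> and
    \<open>h y\<close>.\<close>
  define yv where "yv u = (\<chi> m. y $ m * pairing_map v (vec_divide u x) $ m)" for u
  define zw where "zw u = (\<chi> i. h y $ i * pairing_map w (vec_divide u x) $ i)" for u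
  have div: "vec_divide (yv u) y = pairing_map v (vec_divide u x)"
    "vec_divide (zw u) (h y) = pairing_map w (vec_divide u x)" for u
    using y by (simp_all add: yv_def zw_def vec_divide_def in_torus_def vec_eq_iff)
  have cancel: "u = 0" if "pairing_map v (vec_divide u x) = 0" "pairing_map w (vec_divide u x) = 0" for u
    using pairing_maps_inj[OF that] x(1) by (simp add: vec_divide_def vec_eq_iff in_torus_def)
  have lin: "H 0 = 0"
    using has_derivative_linear[OF h] by (rule linear_0)
  have G: "((\<lambda>x. monomial_map w x - h (monomial_map v x)) has_derivative (\<lambda>u. zw u - H (yv u))) (at x)"
  proof -
    have yz: "(monomial_map v has_derivative yv) (at x)" "(monomial_map w has_derivative zw) (at x)"
      using monomial_map_has_derivative[OF x(1), of v] monomial_map_has_derivative[OF x(1), of w]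
      by (simp_all add: x(2,3) yv_def[abs_def] zw_def[abs_def])
    have "(h has_derivative H) (at (monomial_map v x))" using h x(2) by simp
    then show ?thesis
      by (rule has_derivative_diff[OF yz(2) has_derivative_compose[OF yz(1)]])
  qed
  have "(\<forall>u. zw u - H (yv u) = 0 \<longrightarrow> u = 0) \<longleftrightarrow>
    (\<forall>t. (\<chi> j. pairing (\<beta> j) (vec_divide t y) + pairing (\<gamma> j) (vec_divide (H t) (h y))) = 0 \<longrightarrow> t = 0)"
    (is "?A = ?B")
  proof
    assume A: ?A
    show ?B
    proof (intro allI impI)
      fix t
      assume t: "(\<chi> j. pairing (\<beta> j) (vec_divide t y) + pairing (\<gamma> j) (vec_divide (H t) (h y))) = 0"
      have "pairing (\<beta> j) (vec_divide t y) + pairing (\<gamma> j) (vec_divide (H t) (h y)) = 0" for j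
        using arg_cong[OF t, of "\<lambda>z. z $ j"] by simp
      \<comment> \<open>A vector \<open>t\<close> in the Gale kernel gives an additive character
        that kills the generating relations. It therefore comes from a logarithmic tangent vector at
        \<open>x\<close>.\<close>
      then obtain \<xi> where \<xi>: "pairing_map v \<xi> = vec_divide t y"
        "pairing_map w \<xi> = vec_divide (H t) (h y)"
        by (rule pairing_maps_surj)
      define u where "u = (\<chi> k. \<xi> $ k * x $ k)"
      have "vec_divide u x = \<xi>"
        using x(1) by (simp add: u_def vec_divide_def vec_eq_iff in_torus_def)
      then have "yv u = t" "zw u = H t"
        using y by (auto simp: yv_def zw_def \<xi> vec_divide_def vec_eq_iff in_torus_def)
      moreover from this have "u = 0" using A by simp
      ultimately show "t = 0"
        by (auto simp: yv_def vec_divide_def vec_eq_iff pairing_map_def pairing_def)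
    qed
  next
    assume B: ?B
    show ?A
    proof (intro allI impI)
      fix u assume "zw u - H (yv u) = 0"
      then have H: "H (yv u) = zw u" by simp
      \<comment> \<open>The logarithmic vectors of \<open>yv u\<close> and \<open>zw u\<close> come
        from \<open>u\<close>, hence satisfy all relations. Since \<open>zw u\<close> is
        \<open>H (yv u)\<close>, this puts \<open>yv u\<close> in the Gale kernel.\<close>
      have "yv u = 0"
        using B[rule_format, of "yv u"] pairing_relation_on_image[OF relation]
        by (simp add: H div vec_eq_iff)
      moreover from this have "zw u = 0" using H lin by simp
      ultimately show "u = 0"
        by (intro cancel[of u]; subst div[symmetric]) (simp_all add: vec_divide_def vec_eq_iff)
    qed
  qed
  moreover have "monomial_map w x - h (monomial_map v x) = 0" using x by simp
  ultimately show ?thesis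
    unfolding nondegenerate_zero_iff[OF G] nondegenerate_zero_iff[OF gale_map_has_derivative[OF h y zero]]
    using zero by simp
qed

text \<open>At a solution x^w is forced to be \<open>h y\<close> with y = x^v, so \<open>y\<close>
  determines \<open>x\<close>. Conversely the Gale equations let the character (y, h y) extend to a
  point \<open>x\<close>.\<close>

theorem gale_duality_bij:
  fixes h :: "real ^ 'l \<Rightarrow> real ^ 'n" and F :: "real ^ 'n \<Rightarrow> real ^ 'n"
  assumes h: "\<And>y. in_torus y \<Longrightarrow> h differentiable (at y)"
    and F: "\<And>x. in_torus x \<Longrightarrow> F x = lmonom a x *\<^sub>R (C *v (monomial_map w x - h (monomial_map v x)))"
    and C: "invertible C"
  shows "bij_betw (monomial_map v) {x. coords_in S x \<and> nondegenerate_zero F x}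
    {y. coords_in S y \<and> coords_in S (h y) \<and> nondegenerate_zero (gale_map h \<beta> \<gamma>) y}"
proof -
  \<comment> \<open>First the monomial unit and the matrix \<open>C\<close> are removed, then the
    kernels are compared.\<close>
  have reduce: "nondegenerate_zero F x \<longleftrightarrow> monomial_map w x = h (monomial_map v x) \<and>
      nondegenerate_zero (gale_map h \<beta> \<gamma>) (monomial_map v x)" if x: "coords_in S x" for x
  proof -
    have T: "in_torus x" using x by (rule coords_in_torus)
    obtain H where H: "(h has_derivative H) (at (monomial_map v x))"
      using h[OF monomial_map_torus[OF T]] by (auto simp: differentiable_def)
    have G: "((\<lambda>x. monomial_map w x - h (monomial_map v x)) has_derivative
      (\<lambda>u. (\<chi> i. monomial_map w x $ i * pairing_map w (vec_divide u x) $ i) -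
        H (\<chi> m. monomial_map v x $ m * pairing_map v (vec_divide u x) $ m))) (at x)"
      by (intro has_derivative_diff monomial_map_has_derivative[OF T]
          has_derivative_compose[OF monomial_map_has_derivative[OF T] H])
    have diff: "lmonom a differentiable (at x)"
      using lmonom_has_derivative[OF T] unfolding differentiable_def by blast
    have "nondegenerate_zero F x \<longleftrightarrow>
        nondegenerate_zero (\<lambda>x. monomial_map w x - h (monomial_map v x)) x"
      by (rule nondegenerate_zero_gauge[OF open_torus _ _ diff lmonom_nonzero[OF T] G C])
        (simp_all only: mem_Collect_eq T F)
    also have "\<dots> \<longleftrightarrow> monomial_map w x = h (monomial_map v x) \<and>
        nondegenerate_zero (gale_map h \<beta> \<gamma>) (monomial_map v x)"
    proof (cases "monomial_map w x = h (monomial_map v x)")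
      case True
      show ?thesis using nondegenerate_zero_dual[OF T refl True H] True by blast
    next
      case False
      then show ?thesis by (simp add: nondegenerate_zero_def)
    qed
    finally show ?thesis .
  qed
  show ?thesis
  proof (rule bij_betw_imageI)
    show "inj_on (monomial_map v) {x. coords_in S x \<and> nondegenerate_zero F x}"
      by (rule inj_onI) (metis (no_types, lifting) mem_Collect_eq monomial_maps_inj reduce)
    show "monomial_map v ` {x. coords_in S x \<and> nondegenerate_zero F x} =
      {y. coords_in S y \<and> coords_in S (h y) \<and> nondegenerate_zero (gale_map h \<beta> \<gamma>) y}" (is "?L = ?R")
    proof (intro equalityI subsetI)
      fix y assume "y \<in> ?L"
      then obtain x where "coords_in S x" "nondegenerate_zero F x" "y = monomial_map v x" by auto
      then show "y \<in> ?R" using reduce[of x] monomial_map_in[of x] by (metis mem_Collect_eq)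
    next
      fix y assume "y \<in> ?R"
      then have y: "coords_in S y" "coords_in S (h y)" and nd: "nondegenerate_zero (gale_map h \<beta> \<gamma>) y"
        by auto
      \<comment> \<open>The Gale system says precisely that the character is trivial on the
        generating relations.\<close>
      have "lmonom (\<beta> j) y * lmonom (\<gamma> j) (h y) = 1" for j
        using nd by (auto simp: nondegenerate_zero_def gale_map_def vec_eq_iff)
      then obtain x where "coords_in S x" "monomial_map v x = y" "monomial_map w x = h y"
        using monomial_maps_surj[OF y] by blast
      then show "y \<in> ?L" using reduce[of x] nd by blast
    qed
  qed
qed

end

subsection \<open>Sublattices of finite index\<close>

lemma rat_vec_common_denominator:
  fixes z :: "rat ^ 's::finite"
  obtains M :: nat and b :: "int ^ 's" where "M > 0" "\<And>s. of_nat M * z $ s = of_int (b $ s)"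
proof -
  have "\<exists>(d::nat) n. d > 0 \<and> of_nat d * z $ s = of_int n" for s
  proof -
    obtain n d where nd: "z $ s = of_int n / of_int d" "d > 0"
      using quotient_of_div quotient_of_denom_pos by (metis surj_pair)
    have "of_nat (nat d) * z $ s = of_int n"
      using nd by (simp add: of_nat_nat)
    then show ?thesis using nd(2) by (metis zero_less_nat_eq)
  qed
  then obtain d :: "'s \<Rightarrow> nat" and n where dn: "\<And>s. d s > 0" "\<And>s. of_nat (d s) * z $ s = of_int (n s)"
    by metis
  \<comment> \<open>The product of all denominators is cleared; each numerator absorbs the
    denominators of the other coordinates.\<close>
  define b where "b = (\<chi> s. int (\<Prod>t\<in>UNIV - {s}. d t) * n s)"
  have "of_nat (\<Prod>t\<in>UNIV. d t) * z $ s = of_int (b $ s)" for s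
  proof -
    have "(\<Prod>t\<in>UNIV. d t) = d s * (\<Prod>t\<in>UNIV - {s}. d t)"
      by (rule prod.remove) auto
    then show ?thesis by (simp add: b_def mult_ac flip: dn(2))
  qed
  moreover have "(\<Prod>t\<in>UNIV. d t) > 0" using dn(1) by (simp add: prod_pos)
  ultimately show ?thesis using that by blast
qed

text \<open>Rank--nullity over the rationals: a kernel generated by few elements forces the image to be
  large.\<close>

lemma multiple_in_range_combine:
  fixes u :: "'s::finite \<Rightarrow> int ^ 'n::finite" and g :: "'j::finite \<Rightarrow> int ^ 's"
  assumes gen: "\<And>b. combine u b = 0 \<Longrightarrow> b \<in> group_closure (range g)"
    and card: "CARD('s) = CARD('j) + CARD('n)"
  shows "\<exists>N>0. \<exists>b. axis k (int N) = combine u b"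
proof -
  define A :: "rat ^ 's ^ 'n" where "A = (\<chi> k s. of_int (u s $ k))"
  define q :: "int ^ 's \<Rightarrow> rat ^ 's" where "q b = (\<chi> s. of_int (b $ s))" for b
  have Aq: "(A *v q b) $ k = of_int (combine u b $ k)" for b k
    by (simp add: A_def q_def matrix_vector_mult_def combine_nth mult.commute)
  define K where "K = range (\<lambda>j. q (g j))"
  \<comment> \<open>A rational kernel vector becomes an integral one after clearing denominators, so
    \<open>gen\<close> applies to it; the factor is divided out afterwards.\<close>
  have kernel: "z \<in> vec.span K" if z: "A *v z = 0" for z
  proof -
    obtain M b where M: "M > 0" "\<And>s. of_nat M * z $ s = of_int (b $ s)"
      using rat_vec_common_denominator by blast
    have qb: "q b = of_nat M *s z" using M(2) by (simp add: q_def vec_eq_iff)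
    have "A *v q b = 0" unfolding qb by (simp add: vec.scale z)
    then have "combine u b = 0"
      using Aq[of b] by (simp add: vec_eq_iff)
    then have "b \<in> group_closure (range g)" by (rule gen)
    then have "q b \<in> vec.span K"
    proof induction
      case (base b)
      \<comment> \<open>Besides the generators, 0 is a base element of
        \<open>group_closure\<close>.\<close>
      moreover have "q 0 = 0" by (simp add: q_def vec_eq_iff)
      ultimately show ?case by (auto simp: K_def intro: vec.span_base vec.span_zero)
    next
      case (diff a b)
      moreover have "q (a - b) = q a - q b" by (simp add: q_def vec_eq_iff)
      ultimately show ?case by (simp add: vec.span_diff)
    qed
    then have "(1 / of_nat M) *s q b \<in> vec.span K" by (rule vec.span_scale)
    then show ?thesis using M(1) by (simp add: qb)
  qed
  have "range ((*v) A) = UNIV"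
  proof (rule ccontr)
    assume nonsurj: "range ((*v) A) \<noteq> UNIV"
    define D where "D = range ((*v) A)"
    obtain B where B: "B \<subseteq> D" "vec.independent B" "D \<subseteq> vec.span B" "card B = vec.dim D"
      using vec.basis_exists by blast
    have "vec.subspace D"
      unfolding D_def by (intro vec.subspace_image vec.subspace_UNIV)
    then have "vec.dim D \<noteq> CARD('n)"
      using nonsurj vec.dim_eq_full[of D]
      by (simp add: D_def vec.dimension_def card_cart_basis vec.span_eq_iff[THEN iffD2])
    moreover have "vec.dim D \<le> CARD('n)"
      using vec.dim_subset_UNIV[of D] by (simp add: vec.dimension_def card_cart_basis)
    ultimately have dimD: "card B < CARD('n)" using B(4) by simp
    have finB: "finite B" using B(2) by (rule vec.finiteI_independent)
    obtain p where p: "\<And>b. b \<in> B \<Longrightarrow> A *v p b = b"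
      using B(1) unfolding D_def by (metis (full_types) image_iff subset_eq)
    \<comment> \<open>The kernel together with lifts of a basis of the image spans everything. With
      an image of dimension below \<open>CARD('n)\<close> this leaves too few vectors for dimension
      \<open>CARD('s)\<close>.\<close>
    have "x \<in> vec.span (K \<union> p ` B)" for x
    proof -
      have "B = (*v) A ` p ` B" using p by (force simp: image_image)
      then have "vec.span B = (*v) A ` vec.span (p ` B)"
        by (metis vec.span_image)
      then obtain y where y: "y \<in> vec.span (p ` B)" "A *v x = A *v y"
        using B(3) unfolding D_def by (metis (no_types, lifting) image_iff rangeI subset_eq)
      have "x - y \<in> vec.span K" by (rule kernel) (simp add: vec.diff y)
      then have "(x - y) + y \<in> vec.span (K \<union> p ` B)"
        using y(1) by (meson vec.span_add vec.span_mono in_mono sup_ge1 sup_ge2)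
      then show ?thesis by simp
    qed
    then have "vec.dim (UNIV :: (rat ^ 's) set) \<le> card (K \<union> p ` B)"
      by (intro vec.dim_le_card) (auto simp: K_def finB)
    also have "\<dots> \<le> card K + card (p ` B)" by (rule card_Un_le)
    also have "\<dots> \<le> CARD('j) + card B"
      unfolding K_def by (intro add_mono card_image_le finB) auto
    finally show False using dimD card by (simp add: card_cart_basis)
  qed
  \<comment> \<open>A rational preimage of the unit vector; its common denominator is the required
    multiple.\<close>
  then obtain z where z: "A *v z = axis k 1" by (metis surjD)
  obtain M b where M: "M > 0" "\<And>s. of_nat M * z $ s = of_int (b $ s)"
    using rat_vec_common_denominator by blast
  have qb: "q b = of_nat M *s z" using M(2) by (simp add: q_def vec_eq_iff)
  have "A *v q b = of_nat M *s axis k 1" unfolding qb by (simp add: vec.scale z)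
  then have "of_int (combine u b $ i) = (of_int (axis k (int M) $ i) :: rat)" for i
    using Aq[of b i] by (cases "i = k") (simp_all add: axis_def)
  then have "axis k (int M) = combine u b" by (simp add: vec_eq_iff)
  then show ?thesis using M(1) by blast
qed

text \<open>Only \<open>CARD('l)\<close> elements generate the relations among
  \<open>CARD('l) + CARD('n)\<close> exponents, so by rank the exponents span a sublattice of full
  rank. This supplies \<open>N\<close> in the positive case.\<close>

lemma span_multiple_of_relations_generated:
  fixes v :: "'l::finite \<Rightarrow> int ^ 'n::finite" and w :: "'n \<Rightarrow> int ^ 'n"
    and \<beta> :: "'l \<Rightarrow> int ^ 'l" and \<gamma> :: "'l \<Rightarrow> int ^ 'n"
  assumes gen: "linear_relations v w \<subseteq> group_closure (range (\<lambda>j. (\<beta> j, \<gamma> j)))"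
  shows "\<exists>N>0. \<forall>k. \<exists>b c. axis k (int N) = combine v b + combine w c"
proof -
  define u where "u = case_sum v w"
  define pair :: "(int ^ 'l) \<times> (int ^ 'n) \<Rightarrow> int ^ ('l + 'n)"
    where "pair r = (\<chi> s. case s of Inl m \<Rightarrow> fst r $ m | Inr i \<Rightarrow> snd r $ i)" for r
  have u: "combine u b = combine v (\<chi> m. b $ Inl m) + combine w (\<chi> i. b $ Inr i)" for b
    by (simp add: combine_def u_def UNIV_sum sum.Plus[unfolded Plus_def])
  have pair0: "pair (0, 0) = 0" and pair_diff: "pair (r - s) = pair r - pair s" for r s
    by (simp_all add: pair_def vec_eq_iff split: sum.split)
  have closure: "pair r \<in> group_closure (range (\<lambda>j. pair (\<beta> j, \<gamma> j)))"
    if "r \<in> group_closure (range (\<lambda>j. (\<beta> j, \<gamma> j)))" for r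
    using that
  proof induction
    case (base r)
    then show ?case using pair0 by (auto simp: zero_prod_def intro: group_closure.base)
  next
    case (diff r s)
    then show ?case by (simp add: pair_diff group_closure.diff)
  qed
  have "\<exists>N>0. \<exists>b. axis k (int N) = combine u b" for k
  proof (rule multiple_in_range_combine)
    fix b assume "combine u b = 0"
    then have "((\<chi> m. b $ Inl m), (\<chi> i. b $ Inr i)) \<in> linear_relations v w"
      by (simp add: mem_linear_relations u)
    then have "pair ((\<chi> m. b $ Inl m), (\<chi> i. b $ Inr i)) \<in> group_closure (range (\<lambda>j. pair (\<beta> j, \<gamma> j)))"
      using gen closure by blast
    moreover have "pair ((\<chi> m. b $ Inl m), (\<chi> i. b $ Inr i)) = b"
      by (simp add: pair_def vec_eq_iff split: sum.split)
    ultimately show "b \<in> group_closure (range (\<lambda>j. pair (\<beta> j, \<gamma> j)))" by simp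
  qed simp
  then obtain N b where N: "\<And>k. N k > 0" "\<And>k. axis k (int (N k)) = combine u (b k)"
    by metis
  \<comment> \<open>The multiples found for the separate unit vectors are merged into one by taking
    their product.\<close>
  have "axis k (int (\<Prod>k\<in>UNIV. N k)) = combine u (int (\<Prod>i\<in>UNIV - {k}. N i) *s b k)" for k
  proof -
    have scale: "combine u (a *s b) = a *s combine u b" for a b
      by (simp add: vec_eq_iff combine_nth sum_distrib_left mult.assoc)
    have "(\<Prod>k\<in>UNIV. N k) = N k * (\<Prod>i\<in>UNIV - {k}. N i)"
      by (rule prod.remove) auto
    then show ?thesis
      by (simp add: scale flip: N(2)) (simp add: vec_eq_iff axis_def)
  qed
  moreover have "(\<Prod>k\<in>UNIV. N k) > 0" using N(1) by (simp add: prod_pos)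
  ultimately show ?thesis unfolding u by blast
qed

text \<open>Translation by \<open>x\<close> permutes the cosets, so summing representatives before and after the
  translation shows that \<open>x\<close> is annihilated by the index.\<close>

lemma sum_card_cosets_mem:
  fixes H K :: "'a::ab_group_add set"
  defines "Q \<equiv> (\<lambda>x. (+) x ` H) ` K"
  assumes H: "0 \<in> H" "\<And>a b. a \<in> H \<Longrightarrow> b \<in> H \<Longrightarrow> a - b \<in> H"
    and K: "\<And>a b. a \<in> K \<Longrightarrow> b \<in> K \<Longrightarrow> a + b \<in> K"
    and fin: "finite Q" and x: "x \<in> K"
  shows "(\<Sum>i<card Q. x) \<in> H"
proof -
  have neg: "- a \<in> H" if "a \<in> H" for a using H(2)[OF H(1) that] by simp
  have add: "a + b \<in> H" if "a \<in> H" "b \<in> H" for a b using H(2)[OF that(1) neg[OF that(2)]] by simp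
  have sum: "(\<Sum>i\<in>I. g i) \<in> H" if "\<And>i. i \<in> I \<Longrightarrow> g i \<in> H" for g and I :: "'a set set"
    using that by (induction I rule: infinite_finite_induct) (auto intro: H(1) add)
  define \<sigma> where "\<sigma> q = (+) x ` q" for q
  have coset: "\<sigma> ((+) y ` H) = (+) (x + y) ` H" for y
    by (simp add: \<sigma>_def image_image add.assoc)
  have "\<sigma> ` Q \<subseteq> Q"
    using K x by (auto simp: Q_def coset)
  moreover have inj: "inj_on \<sigma> Q"
    by (rule inj_onI) (simp add: \<sigma>_def inj_image_eq_iff)
  ultimately have bij: "bij_betw \<sigma> Q Q"
    using fin by (simp add: bij_betw_def endo_inj_surj)
  have "\<forall>q\<in>Q. \<exists>y. q = (+) y ` H" by (auto simp: Q_def)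
  then obtain r where r: "\<And>q. q \<in> Q \<Longrightarrow> q = (+) (r q) ` H" by metis
  \<comment> \<open>Both x + r q and the representative of the translated coset lie in that coset.
    Summed over all cosets, the representatives cancel and \<open>card Q\<close> copies of
    \<open>x\<close> remain.\<close>
  have step: "x + r q - r (\<sigma> q) \<in> H" if q: "q \<in> Q" for q
  proof -
    have "\<sigma> q \<in> Q" using bij q by (auto simp: bij_betw_def)
    then have "(+) (x + r q) ` H = (+) (r (\<sigma> q)) ` H"
      using r[OF q] r[of "\<sigma> q"] coset[of "r q"] by metis
    moreover have "x + r q \<in> (+) (x + r q) ` H" using H(1) by (force simp: image_iff)
    ultimately obtain h where "h \<in> H" "x + r q = r (\<sigma> q) + h" by auto
    then show ?thesis by simp
  qed
  have "(\<Sum>q\<in>Q. x + r q - r (\<sigma> q)) = (\<Sum>q\<in>Q. x) + (\<Sum>q\<in>Q. r q) - (\<Sum>q\<in>Q. r (\<sigma> q))"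
    by (simp add: sum_subtractf sum.distrib)
  also have "(\<Sum>q\<in>Q. r (\<sigma> q)) = (\<Sum>q\<in>Q. r q)"
    by (rule sum.reindex_bij_betw[OF bij])
  finally have "(\<Sum>q\<in>Q. x) \<in> H"
    using sum[of Q "\<lambda>q. x + r q - r (\<sigma> q)"] step by simp
  moreover obtain e where "bij_betw e {..<card Q} Q"
    using fin ex_bij_betw_nat_finite by (metis atLeast0LessThan)
  then have "(\<Sum>i<card Q. x) = (\<Sum>q\<in>Q. x)"
    by (rule sum.reindex_bij_betw[of _ _ _ "\<lambda>_. x"])
  ultimately show ?thesis by simp
qed

lemma odd_index_group_closure_multiple:
  assumes "odd_index (group_closure G) K"
    and "\<And>a b. a \<in> K \<Longrightarrow> b \<in> K \<Longrightarrow> a + b \<in> K"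
  obtains N :: nat where "odd N" "\<And>x. x \<in> K \<Longrightarrow> (\<Sum>i<N. x) \<in> group_closure G"
proof (rule that[of "card ((\<lambda>x. (+) x ` group_closure G) ` K)"])
  show "odd (card ((\<lambda>x. (+) x ` group_closure G) ` K))"
    using assms(1) by (simp add: odd_index_def)
  show "(\<Sum>i<card ((\<lambda>x. (+) x ` group_closure G) ` K). x) \<in> group_closure G" if "x \<in> K" for x
    using assms that by (intro sum_card_cosets_mem) (auto simp: odd_index_def intro: group_closure.diff)
qed

subsection \<open>Dense fewnomials\<close>

text \<open>An additive map on integer vectors is linear over the integers. This is shown on
  multiples of unit vectors, by induction and negation, and then summed over coordinates.\<close>

lemma affine_linear_eq_combine:
  fixes \<psi> :: "int ^ 'l::finite \<Rightarrow> int ^ 'n"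
  assumes "affine_linear \<psi>"
  shows "\<psi> p = \<psi> 0 + combine (gale_v \<psi>) p"
proof -
  define \<phi> where "\<phi> p = \<psi> p - \<psi> 0" for p
  interpret additive \<phi>
    using assms by (simp add: affine_linear_def \<phi>_def[abs_def])
  have nat: "\<phi> (axis m (int k)) = int k *s \<phi> (axis m 1)" for m k
  proof (induction k)
    case 0
    have "axis m (int 0) = 0" by (simp add: vec_eq_iff axis_def)
    then show ?case by (simp only: zero) simp
  next
    case (Suc k)
    have "axis m (int (Suc k)) = axis m 1 + axis m (int k)"
      by (simp add: vec_eq_iff axis_def)
    then show ?case by (simp only: add Suc) (simp add: vec_eq_iff algebra_simps)
  qed
  have scale: "\<phi> (axis m k) = k *s \<phi> (axis m 1)" for m k
  proof (cases k rule: int_cases2)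
    case (nonneg n)
    then show ?thesis by (simp add: nat)
  next
    case (nonpos n)
    have "axis m k = - axis m (int n)" by (simp add: vec_eq_iff axis_def nonpos)
    then show ?thesis by (simp only: minus nat) (simp add: nonpos vec_eq_iff)
  qed
  have "p = (\<Sum>m\<in>UNIV. axis m (p $ m))"
    by (simp add: vec_eq_iff axis_def)
  then have "\<phi> p = (\<Sum>m\<in>UNIV. \<phi> (axis m (p $ m)))"
    using sum by metis
  also have "\<dots> = combine (gale_v \<psi>) p"
    by (subst scale) (simp add: combine_def gale_v_def \<phi>_def)
  finally show ?thesis by (simp add: \<phi>_def algebra_simps)
qed

text \<open>A common summation set lets polynomials with different supports be added
  termwise.\<close>

lemma laurent_eval_superset:
  "finite T \<Longrightarrow> Poly_Mapping.keys f \<subseteq> T \<Longrightarrow>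
    laurent_eval f x = (\<Sum>a\<in>T. Poly_Mapping.lookup f a * lmonom a x)"
  unfolding laurent_eval_def by (rule sum.mono_neutral_left) (auto simp: in_keys_iff)

lemma laurent_eval_zero [simp]: "laurent_eval 0 x = 0"
  by (simp add: laurent_eval_def)

lemma laurent_eval_add: "laurent_eval (f + g) x = laurent_eval f x + laurent_eval g x"
  using Poly_Mapping.keys_add[of f g]
  by (simp add: laurent_eval_superset[of "Poly_Mapping.keys f \<union> Poly_Mapping.keys g"]
      lookup_add distrib_right sum.distrib)

lemma laurent_eval_sum: "laurent_eval (\<Sum>i\<in>I. f i) x = (\<Sum>i\<in>I. laurent_eval (f i) x)"
  by (induction I rule: infinite_finite_induct) (simp_all add: laurent_eval_add)

lemma laurent_eval_single [simp]: "laurent_eval (Poly_Mapping.single a r) x = r * lmonom a x"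
  by (simp add: laurent_eval_def)

section \<open>The fewnomial system in Gale form\<close>

lemma gale_h_eq:
  "gale_h d c C y = - (matrix_inv C *v (\<chi> j. \<Sum>p\<in>simplex_points d. c j p * lmonom p y))"
proof -
  have "(\<Sum>p\<in>simplex_points d. (\<Sum>j\<in>UNIV. matrix_inv C $ i $ j * c j p) * lmonom p y) =
    (\<Sum>j\<in>UNIV. \<Sum>p\<in>simplex_points d. matrix_inv C $ i $ j * (c j p * lmonom p y))" for i
    unfolding sum_distrib_right mult.assoc by (rule sum.swap)
  then show ?thesis
    by (simp add: gale_h_def gale_coeff_def vec_eq_iff matrix_vector_mult_def sum_distrib_left
        sum_negf)
qed

lemma gale_h_differentiable:
  fixes y :: "real ^ 'l::finite"
  assumes "in_torus y"
  shows "gale_h d c C differentiable (at y)"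
proof -
  have "(gale_h d c C has_derivative (\<lambda>t. \<chi> i. \<Sum>p\<in>simplex_points d.
      gale_coeff c C i p * (lmonom p y * pairing p (vec_divide t y)))) (at y)"
    by (rule has_derivative_vec)
      (auto simp: gale_h_def intro!: has_derivative_sum has_derivative_mult_right
        lmonom_has_derivative assms)
  then show ?thesis by (auto simp: differentiable_def)
qed

text \<open>The unit with exponent \<open>\<psi> 0\<close> factors out of every monomial. What
  remains is C x^w plus the dense part \<open>q\<close>, and q = - C h because h = - C^(-1)
  q.\<close>

lemma fewnomial_map_eq_gale:
  fixes f :: "'n::finite \<Rightarrow> 'n laurent" and \<psi> :: "int ^ 'l::finite \<Rightarrow> int ^ 'n"
  assumes \<psi>: "affine_linear \<psi>"
    and f: "\<And>i. f i = dense_combination d \<psi> w (c i) (C $ i)"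
    and C: "invertible C" and x: "in_torus x"
  shows "fewnomial_map f x = lmonom (\<psi> 0) x *\<^sub>R
    (C *v (monomial_map (gale_w \<psi> w) x - gale_h d c C (monomial_map (gale_v \<psi>) x)))"
proof -
  let ?y = "monomial_map (gale_v \<psi>) x"
  define q where "q = (\<chi> j. \<Sum>p\<in>simplex_points d. c j p * lmonom p ?y)"
  define \<mu> where "\<mu> = lmonom (\<psi> 0) x"
  have \<psi>p: "lmonom (\<psi> p) x = \<mu> * lmonom p ?y" for p
    by (subst affine_linear_eq_combine[OF \<psi>]) (simp add: \<mu>_def lmonom_add x lmonom_monomial_map)
  have wj: "lmonom (w j) x = \<mu> * monomial_map (gale_w \<psi> w) x $ j" for j
    using lmonom_add[OF x, of "\<psi> 0" "gale_w \<psi> w j"]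
    by (simp add: \<mu>_def monomial_map_def gale_w_def)
  have "C ** matrix_inv C = mat 1"
    using someI_ex[OF C[unfolded invertible_def]] by (simp add: matrix_inv_def)
  then have "C *v gale_h d c C ?y = - q"
    unfolding gale_h_eq q_def[symmetric] by (simp add: vec.neg matrix_vector_mul_assoc)
  then have rhs: "C *v (monomial_map (gale_w \<psi> w) x - gale_h d c C ?y) =
      C *v monomial_map (gale_w \<psi> w) x + q"
    by (simp add: vec.diff)
  have "laurent_eval (f i) x =
      \<mu> * ((C *v monomial_map (gale_w \<psi> w) x) $ i + q $ i)" for i
    by (simp add: f dense_combination_def laurent_eval_add laurent_eval_sum \<psi>p wj q_def
        matrix_vector_mult_def distrib_left sum_distrib_left mult_ac)
  then show ?thesis
    by (simp add: rhs fewnomial_map_def vec_eq_iff flip: \<mu>_def)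
qed

section \<open>Verification of the character hypotheses over the positive and the nonzero
  reals\<close>

lemma linear_relations_add:
  "r \<in> linear_relations v w \<Longrightarrow> s \<in> linear_relations v w \<Longrightarrow> r + s \<in> linear_relations v w"
proof -
  have "combine v (b + b') + combine w (c + c') =
      (combine v b + combine w c) + (combine v b' + combine w c')" for b b' c c'
    by (simp add: combine_add_right)
  then show "r \<in> linear_relations v w \<Longrightarrow> s \<in> linear_relations v w \<Longrightarrow> r + s \<in> linear_relations v w"
    by (cases r; cases s) (simp add: mem_linear_relations)
qed

text \<open>The translation by \<open>\<psi> 0\<close> cancels in a difference of exponents, so the
  group they generate consists of combinations of the translated vectors.\<close>

lemma exponent_differences_in_span:
  assumes A: "A = \<psi> ` simplex_points d \<union> range w" and \<psi>: "affine_linear \<psi>"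
    and x: "x \<in> group_closure {a - b | a b. a \<in> A \<and> b \<in> A}"
  shows "\<exists>b c. x = combine (gale_v \<psi>) b + combine (gale_w \<psi> w) c"
proof -
  have span_diff: "\<exists>b c. a - a' = combine (gale_v \<psi>) b + combine (gale_w \<psi> w) c"
    if "\<exists>b c. a = combine (gale_v \<psi>) b + combine (gale_w \<psi> w) c"
      "\<exists>b c. a' = combine (gale_v \<psi>) b + combine (gale_w \<psi> w) c" for a a'
    using that by (metis add_diff_add combine_diff_right)
  have mem: "\<exists>b c. a - \<psi> 0 = combine (gale_v \<psi>) b + combine (gale_w \<psi> w) c" if "a \<in> A" for a
  proof -
    from that consider p where "a = \<psi> p" | j where "a = w j" by (auto simp: A)
    then show ?thesis
    proof cases
      case 1
      then have "a - \<psi> 0 = combine (gale_v \<psi>) p + combine (gale_w \<psi> w) 0"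
        using affine_linear_eq_combine[OF \<psi>, of p] by simp
      then show ?thesis by blast
    next
      case 2
      then have "a - \<psi> 0 = combine (gale_v \<psi>) 0 + combine (gale_w \<psi> w) (axis j 1)"
        by (simp add: combine_axis gale_w_def)
      then show ?thesis by blast
    qed
  qed
  show ?thesis
    using x
  proof induction
    case (base x)
    then consider "x = 0" | a b where "a \<in> A" "b \<in> A" "x = a - b" by auto
    then show ?case
    proof cases
      case 1
      then have "x = combine (gale_v \<psi>) 0 + combine (gale_w \<psi> w) 0" by simp
      then show ?thesis by blast
    next
      case 2
      then show ?thesis using span_diff[OF mem mem, of a b] by simp
    qed
  next
    case (diff a b)
    then show ?case using span_diff by blast
  qed
qed

lemma sum_axis: "(\<Sum>i<N. axis k (1::int)) = axis k (int N)"
  by (induction N) (simp_all add: vec_eq_iff axis_def del: sum_constant)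

text \<open>Positive reals have unique roots of every positive order, so any \<open>N\<close> from
  the rank argument is good. \<open>M\<close> is 1 because the given relations generate all of
  them.\<close>

lemma gale_exponents_positive:
  assumes basis: "group_closure (range (\<lambda>j. (\<beta> j, \<gamma> j))) = linear_relations v w"
  obtains N where "gale_exponents v w \<beta> \<gamma> {0<..} N 1"
proof -
  obtain N where N: "N > 0" "\<And>k. \<exists>b c. axis k (int N) = combine v b + combine w c"
    using span_multiple_of_relations_generated[of v w \<beta> \<gamma>] basis by auto
  have "gale_exponents v w \<beta> \<gamma> {0<..} N 1"
  proof
    show "(\<beta> j, \<gamma> j) \<in> linear_relations v w" for j
      unfolding basis[symmetric] by (rule group_closure.base) auto
    show "\<exists>t\<in>{0<..}. t ^ N = s" if "s \<in> {0<..}" for s :: real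
      using that N(1) by (intro bexI[of _ "root N s"]) auto
    show "s = 1" if "s \<in> {0<..}" "s ^ N = 1" for s :: real
      using that N(1) power_eq_iff_eq_base[of N s 1] by simp
  qed (use N basis in auto)
  then show ?thesis by (rule that)
qed

text \<open>Odd powers permute the nonzero reals, which gives unique \<open>N\<close>-th roots and
  excludes \<open>M\<close>-torsion.\<close>

lemma gale_exponents_torus:
  assumes rel: "\<And>j. (\<beta> j, \<gamma> j) \<in> linear_relations v w"
    and M: "odd M" "\<And>r. r \<in> linear_relations v w \<Longrightarrow>
      (\<Sum>i<M. r) \<in> group_closure (range (\<lambda>j. (\<beta> j, \<gamma> j)))"
    and N: "odd N" "\<And>k. \<exists>b c. axis k (int N) = combine v b + combine w c"
  shows "gale_exponents v w \<beta> \<gamma> (- {0}) N M"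
proof
  have torsion_free: "s = 1" if "odd n" "s ^ n = 1" for s :: real and n
    using odd_real_root_power_cancel[OF that(1), of s] that odd_pos[OF that(1)] by simp
  show "s = 1" if "s ^ N = 1" for s :: real using torsion_free N(1) that .
  show "s = 1" if "s ^ M = 1" for s :: real using torsion_free M(1) that .
  show "\<exists>t\<in>- {0}. t ^ N = s" if "s \<in> - {0}" for s :: real
    using that N(1) odd_pos[OF N(1)] by (intro bexI[of _ "root N s"]) (auto simp: odd_real_root_pow)
qed (use assms odd_pos in auto)

theorem theorem2p9:
  fixes d :: nat
    and \<psi> :: "int ^ 'l \<Rightarrow> int ^ 'n"
    and w :: "'n \<Rightarrow> int ^ 'n"
    and A :: "(int ^ 'n) set"
    and f :: "'n::finite \<Rightarrow> 'n laurent"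
    and c :: "'n \<Rightarrow> int ^ 'l \<Rightarrow> real"
    and C :: "real ^ 'n ^ 'n"
    and \<beta> :: "'l::finite \<Rightarrow> int ^ 'l"
    and \<gamma> :: "'l \<Rightarrow> int ^ 'n"
  assumes "d \<ge> 1"
    and "dense_exponents d \<psi> w A"
    and "\<And>i. Poly_Mapping.keys (f i) \<subseteq> A"
    and "\<And>i. f i = dense_combination d \<psi> w (c i) (C $ i)"
    and "invertible C"
  shows
    "(is_Z_basis \<beta> \<gamma> (linear_relations (gale_v \<psi>) (gale_w \<psi> w)) \<longrightarrow>
        {x. positive_vec x \<and> nondegenerate_zero (fewnomial_map f) x} \<approx>
        {y. positive_vec y \<and> positive_vec (gale_h d c C y)
           \<and> nondegenerate_zero (gale_map (gale_h d c C) \<beta> \<gamma>) y})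
     \<and>
     (affine_odd_index A \<and>
      (\<forall>j. (\<beta> j, \<gamma> j) \<in> linear_relations (gale_v \<psi>) (gale_w \<psi> w)) \<and>
      odd_index (group_closure (range (\<lambda>j. (\<beta> j, \<gamma> j)))) (linear_relations (gale_v \<psi>) (gale_w \<psi> w)) \<longrightarrow>
        {x. in_torus x \<and> nondegenerate_zero (fewnomial_map f) x} \<approx>
        {y. in_torus y \<and> in_torus (gale_h d c C y)
           \<and> nondegenerate_zero (gale_map (gale_h d c C) \<beta> \<gamma>) y})"
proof -
  let ?v = "gale_v \<psi>" and ?w = "gale_w \<psi> w" and ?h = "gale_h d c C"
  let ?R = "linear_relations ?v ?w"
  have \<psi>: "affine_linear \<psi>" and A: "A = \<psi> ` simplex_points d \<union> range w"
    using assms(2) by (auto simp: dense_exponents_def)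
  \<comment> \<open>The unit in \<open>gale_duality_bij\<close> is the monomial with exponent
    \<open>\<psi> 0\<close>; the two halves differ only in \<open>S\<close>, \<open>N\<close> and
    \<open>M\<close>.\<close>
  have duality: "{x. coords_in S x \<and> nondegenerate_zero (fewnomial_map f) x} \<approx>
      {y. coords_in S y \<and> coords_in S (?h y) \<and> nondegenerate_zero (gale_map ?h \<beta> \<gamma>) y}"
    if "gale_exponents ?v ?w \<beta> \<gamma> S N M" for S N M
    unfolding eqpoll_def
    using gale_exponents.gale_duality_bij[OF that gale_h_differentiable
        fewnomial_map_eq_gale[OF \<psi> assms(4,5)] assms(5)]
    by blast
  have positive: "positive_vec x \<longleftrightarrow> coords_in {0<..} x"
    and torus: "in_torus x \<longleftrightarrow> coords_in (- {0}) x" for x :: "real ^ 'k::finite"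
    by (simp_all add: positive_vec_def in_torus_def coords_in_def)
  show ?thesis
  proof (intro conjI impI)
    assume "is_Z_basis \<beta> \<gamma> ?R"
    then have "group_closure (range (\<lambda>j. (\<beta> j, \<gamma> j))) = ?R"
      by (simp add: is_Z_basis_def)
    then obtain N where "gale_exponents ?v ?w \<beta> \<gamma> {0<..} N 1"
      by (rule gale_exponents_positive)
    then show "{x. positive_vec x \<and> nondegenerate_zero (fewnomial_map f) x} \<approx>
        {y. positive_vec y \<and> positive_vec (?h y) \<and> nondegenerate_zero (gale_map ?h \<beta> \<gamma>) y}"
      unfolding positive by (rule duality)
  next
    let ?D = "{a - b | a b. a \<in> A \<and> b \<in> A}"
    assume "affine_odd_index A \<and> (\<forall>j. (\<beta> j, \<gamma> j) \<in> ?R) \<and>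
      odd_index (group_closure (range (\<lambda>j. (\<beta> j, \<gamma> j)))) ?R"
    then have odd: "odd_index (group_closure ?D) UNIV"
        "odd_index (group_closure (range (\<lambda>j. (\<beta> j, \<gamma> j)))) ?R"
      and rel: "\<And>j. (\<beta> j, \<gamma> j) \<in> ?R"
      by (simp_all add: affine_odd_index_def)
    obtain M :: nat where M: "odd M" "\<And>r. r \<in> ?R \<Longrightarrow>
        (\<Sum>i<M. r) \<in> group_closure (range (\<lambda>j. (\<beta> j, \<gamma> j)))"
      using odd_index_group_closure_multiple[OF odd(2) linear_relations_add] by blast
    obtain N :: nat where N: "odd N" "\<And>x. x \<in> UNIV \<Longrightarrow> (\<Sum>i<N. x) \<in> group_closure ?D"
      using odd_index_group_closure_multiple[OF odd(1) UNIV_I] by blast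
    \<comment> \<open>Annihilation by the index, applied to a unit vector, puts N times that vector
      into the group of exponent differences.\<close>
    have span: "\<exists>b c. axis k (int N) = combine ?v b + combine ?w c" for k
      by (rule exponent_differences_in_span[OF A \<psi> N(2)[OF UNIV_I, of "axis k 1"], unfolded sum_axis])
    have "gale_exponents ?v ?w \<beta> \<gamma> (- {0}) N M"
      by (rule gale_exponents_torus[OF rel M N(1) span])
    then show "{x. in_torus x \<and> nondegenerate_zero (fewnomial_map f) x} \<approx>
        {y. in_torus y \<and> in_torus (?h y) \<and> nondegenerate_zero (gale_map ?h \<beta> \<gamma>) y}"
      unfolding torus by (rule duality)
  qed
qed

end
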